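(* Let $X$ and $Y$ be random variables following the distributions $\mathrm{CMNB}(r,\nu,p_1)$ and $\mathrm{CMNB}(r,\nu,p_2)$, respectively, where $r,\nu\in(0,\infty)$ and $p_1,p_2\in(0,1)$. If ($p_1\le p_2$ and $\nu\le 1$) or ($p_1\le p_2$ and $r\ge 1$), then $X\le_{lr}Y$, and therefore $X\le_{st}Y$, $X\le_{hr}Y$ and $X\le_{MLR}Y$.
   Context: For $r,\nu\in(0,\infty)$ and $p\in(0,1)$, a random variable $X$ follows the COM-negative binomial distribution $\mathrm{CMNB}(r,\nu,p)$ if $$\mathrm{P}(X=k)=\left(\frac{\Gamma(r+k)}{k!\,\Gamma(r)}\right)^{\nu}p^k(1-p)^r\frac{1}{C(r,\nu,p)},\quad k=0,1,2,\ldots,\qquad C(r,\nu,p)=\sum_{i=0}^{\infty}\left(\frac{\Gamma(r+i)}{i!\,\Gamma(r)}\right)^{\nu}p^i(1-p)^r .$$ Stochastic orders for discrete random variables $X,Y$ on $\{0,1,2,\ldots\}$ with probability mass functions $f$ and $g$, respectively: (1) usual stochastic order: $X\le_{st}Y$ if $S_X(n)\le S_Y(n)$ for all $n$, where $S_X(n)=\mathrm{P}(X\ge n)$; (2) likelihood ratio order: $X\le_{lr}Y$ if $g(n)/f(n)$ is increasing (in the weak sense) in $n$ over the union of the supports of $X$ and $Y$; (3) hazard rate order: $X\le_{hr}Y$ if $r_X(n)\ge r_Y(n)$ for all $n$, where $r_X(n)=\mathrm{P}(X=n)/\sum_{k\ge n}\mathrm{P}(X=k)$; (4) mean residual life order: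 $X\le_{MLR}Y$ if $\mu_X(n)\le\mu_Y(n)$ for all $n$, where $\mu_X(n)=\mathrm{E}(X-n\mid X\ge n)$. *)

theory Defs
  imports "HOL-Probability.Probability"
begin

definition cmnb_weight :: "real \<Rightarrow> real \<Rightarrow> real \<Rightarrow> nat \<Rightarrow> real" where
  "cmnb_weight r \<nu> p k = (Gamma (r + real k) / (fact k * Gamma r)) powr \<nu> * p ^ k * (1 - p) powr r"

definition cmnb_const :: "real \<Rightarrow> real \<Rightarrow> real \<Rightarrow> real" where
  "cmnb_const r \<nu> p = (\<Sum>i. cmnb_weight r \<nu> p i)"

definition has_cmnb :: "'a measure \<Rightarrow> ('a \<Rightarrow> nat) \<Rightarrow> real \<Rightarrow> real \<Rightarrow> real \<Rightarrow> bool" where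
  "has_cmnb M X r \<nu> p \<longleftrightarrow>
     X \<in> measurable M (count_space UNIV) \<and>
     (\<forall>k. \<P>(x in M. X x = k) = cmnb_weight r \<nu> p k * (1 / cmnb_const r \<nu> p))"

text \<open>The orders below compare laws, so the two variables may live on different probability spaces.\<close>

definition st_le :: "'a measure \<Rightarrow> ('a \<Rightarrow> nat) \<Rightarrow> 'b measure \<Rightarrow> ('b \<Rightarrow> nat) \<Rightarrow> bool" where
  "st_le M X N Y \<longleftrightarrow> (\<forall>n. \<P>(x in M. X x \<ge> n) \<le> \<P>(y in N. Y y \<ge> n))"

definition prob_support :: "'a measure \<Rightarrow> ('a \<Rightarrow> nat) \<Rightarrow> nat set" where
  "prob_support M X = {n. \<P>(x in M. X x = n) > 0}"

text \<open>The quotient is taken in \<^typ>\<open>ennreal\<close>, so that it is infinite (not zero) at points of the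
  support of \<open>Y\<close> outside the support of \<open>X\<close>; on the union of the supports it is never of the form 0/0.\<close>

definition lr_le :: "'a measure \<Rightarrow> ('a \<Rightarrow> nat) \<Rightarrow> 'b measure \<Rightarrow> ('b \<Rightarrow> nat) \<Rightarrow> bool" where
  "lr_le M X N Y \<longleftrightarrow>
     mono_on (prob_support M X \<union> prob_support N Y)
       (\<lambda>n. ennreal (\<P>(y in N. Y y = n)) / ennreal (\<P>(x in M. X x = n)))"

text \<open>Where the tail probability vanishes, the hazard rate is infinite by the usual convention.\<close>

definition hazard_rate :: "'a measure \<Rightarrow> ('a \<Rightarrow> nat) \<Rightarrow> nat \<Rightarrow> ennreal" where
  "hazard_rate M X n =
     (if \<P>(x in M. X x \<ge> n) = 0 then \<infinity>
      else ennreal (\<P>(x in M. X x = n) / \<P>(x in M. X x \<ge> n)))"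

definition hr_le :: "'a measure \<Rightarrow> ('a \<Rightarrow> nat) \<Rightarrow> 'b measure \<Rightarrow> ('b \<Rightarrow> nat) \<Rightarrow> bool" where
  "hr_le M X N Y \<longleftrightarrow> (\<forall>n. hazard_rate M X n \<ge> hazard_rate N Y n)"

text \<open>The conditional expectation given \<open>X \<ge> n\<close> is the integral with respect to the conditional
  measure. Its integrand is nonnegative on that event, so the integral is taken in \<^typ>\<open>ennreal\<close>
  and needs no integrability assumption. It is zero where the tail probability vanishes.\<close>

definition mean_residual_life :: "'a measure \<Rightarrow> ('a \<Rightarrow> nat) \<Rightarrow> nat \<Rightarrow> ennreal" where
  "mean_residual_life M X n =
     (\<integral>\<^sup>+ x. ennreal (real (X x) - real n) \<partial>uniform_measure M {x \<in> space M. X x \<ge> n})"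

definition mrl_le :: "'a measure \<Rightarrow> ('a \<Rightarrow> nat) \<Rightarrow> 'b measure \<Rightarrow> ('b \<Rightarrow> nat) \<Rightarrow> bool" where
  "mrl_le M X N Y \<longleftrightarrow> (\<forall>n. mean_residual_life M X n \<le> mean_residual_life N Y n)"

end

theory Submission
  imports Defs
begin

text \<open>Both laws have the same coefficients, so their likelihood ratio at \<open>k\<close> is a constant times
  \<open>(p\<^sub>2 / p\<^sub>1) ^ k\<close>, which increases when \<open>p\<^sub>1 \<le> p\<^sub>2\<close>. Summing the cross-multiplied inequality
  over a tail gives the hazard rate order. Since one minus the hazard rate is the ratio of two
  consecutive tail probabilities, the hazard rate order makes the quotient of the tails monotone.
  Comparing it at \<open>0\<close> gives the usual stochastic order, and summing it gives the mean residual
  life order.\<close>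

section \<open>Tail probabilities and mean residual life of a variable with values in the
  naturals\<close>

context prob_space
begin

lemma sums_prob_ge:
  fixes X :: "'a \<Rightarrow> nat"
  assumes [measurable]: "X \<in> measurable M (count_space UNIV)"
  shows "(\<lambda>k. \<P>(x in M. X x = n + k)) sums \<P>(x in M. X x \<ge> n)"
proof -
  have "(\<lambda>k. prob {x \<in> space M. X x = n + k}) sums prob (\<Union>k. {x \<in> space M. X x = n + k})"
    by (rule finite_measure_UNION) (auto simp: disjoint_family_on_def)
  moreover have "(\<Union>k. {x \<in> space M. X x = n + k}) = {x \<in> space M. X x \<ge> n}"
    by (auto simp: le_iff_add)
  ultimately show ?thesis by simp
qed

lemma prob_ge_eq_prob_eq_plus:
  fixes X :: "'a \<Rightarrow> nat"
  assumes [measurable]: "X \<in> measurable M (count_space UNIV)"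
  shows "\<P>(x in M. X x \<ge> n) = \<P>(x in M. X x = n) + \<P>(x in M. X x \<ge> Suc n)"
proof -
  have "prob ({x \<in> space M. X x = n} \<union> {x \<in> space M. X x \<ge> Suc n})
      = \<P>(x in M. X x = n) + \<P>(x in M. X x \<ge> Suc n)"
    by (rule finite_measure_Union) auto
  moreover have "{x \<in> space M. X x = n} \<union> {x \<in> space M. X x \<ge> Suc n} = {x \<in> space M. X x \<ge> n}"
    by auto
  ultimately show ?thesis by simp
qed

lemma prob_ge_antimono:
  fixes X :: "'a \<Rightarrow> nat"
  assumes [measurable]: "X \<in> measurable M (count_space UNIV)" and "m \<le> n"
  shows "\<P>(x in M. X x \<ge> n) \<le> \<P>(x in M. X x \<ge> m)"
  using assms(2) by (intro finite_measure_mono) auto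

text \<open>The expectation of a natural-valued variable is the sum of its tail probabilities; here
  this is applied to the truncated difference \<open>X x - n\<close> under the conditional
  measure.\<close>

lemma mean_residual_life_eq_suminf:
  fixes X :: "'a \<Rightarrow> nat"
  assumes [measurable]: "X \<in> measurable M (count_space UNIV)"
  shows "mean_residual_life M X n =
    (\<Sum>t. ennreal (\<P>(x in M. X x \<ge> n + Suc t)) / ennreal (\<P>(x in M. X x \<ge> n)))"
proof -
  let ?A = "{x \<in> space M. X x \<ge> n}"
  let ?U = "uniform_measure M ?A"
  have "mean_residual_life M X n = (\<integral>\<^sup>+ x. of_nat (X x - n) \<partial>?U)"
    unfolding mean_residual_life_def
  proof (rule nn_integral_cong)
    fix x
    show "ennreal (real (X x) - real n) = of_nat (X x - n)"
      \<comment> \<open>Below \<open>n\<close> both sides are 0: \<open>ennreal\<close> sends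
        negative reals to 0, and subtraction on naturals is truncated.\<close>
      by (cases "n \<le> X x") (auto simp: ennreal_of_nat_eq_real_of_nat ennreal_neg)
  qed
  also have "\<dots> = (\<Sum>t. emeasure ?U {x \<in> space ?U. t < X x - n})"
    by (rule nn_integral_nat_function) simp
  also have "\<dots> = (\<Sum>t. ennreal (\<P>(x in M. X x \<ge> n + Suc t)) / ennreal (\<P>(x in M. X x \<ge> n)))"
  proof (rule suminf_cong)
    fix t
    have "?A \<inter> {x \<in> space M. t < X x - n} = {x \<in> space M. X x \<ge> n + Suc t}"
      by auto
    then show "emeasure ?U {x \<in> space ?U. t < X x - n}
        = ennreal (\<P>(x in M. X x \<ge> n + Suc t)) / ennreal (\<P>(x in M. X x \<ge> n))"
      by (simp add: emeasure_eq_measure)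
  qed
  finally show ?thesis .
qed

end

section \<open>Implications between the stochastic orders\<close>

text \<open>The product form also covers vanishing masses. If the left side is nonzero, both
  \<open>m\<close> and \<open>n\<close> lie in the union of the supports, so the monotone quotient
  can be compared there.\<close>

lemma lr_le_cross:
  assumes "lr_le M X N Y" and "m \<le> n"
  shows "\<P>(x in M. X x = n) * \<P>(y in N. Y y = m) \<le> \<P>(x in M. X x = m) * \<P>(y in N. Y y = n)"
    (is "?fn * ?gm \<le> ?fm * ?gn")
proof (cases "?fn = 0 \<or> ?gm = 0")
  case False
  then have pos: "?fn > 0" "?gm > 0"
    by (auto simp: less_le)
  have "ennreal ?gm / ennreal ?fm \<le> ennreal ?gn / ennreal ?fn"
    using assms pos unfolding lr_le_def prob_support_def by (auto elim!: mono_onD)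
  also have "\<dots> = ennreal (?gn / ?fn)"
    using pos by (simp add: divide_ennreal)
  finally have le: "ennreal ?gm / ennreal ?fm \<le> ennreal (?gn / ?fn)" .
  \<comment> \<open>Otherwise the quotient at \<open>m\<close> would be infinite, but it is bounded
    by the finite quotient at \<open>n\<close>.\<close>
  have fm: "?fm > 0"
  proof (rule ccontr)
    assume "\<not> ?fm > 0"
    then have "?fm = 0" by (simp add: less_le)
    with le pos show False by (simp add: ennreal_divide_zero top_unique)
  qed
  with le pos have "?gm / ?fm \<le> ?gn / ?fn"
    by (simp add: divide_ennreal)
  with fm pos show ?thesis
    by (simp add: field_simps)
qed auto

lemma lr_le_imp_hr_le:
  assumes "prob_space M" and "prob_space N"
    and X: "X \<in> measurable M (count_space UNIV)" and Y: "Y \<in> measurable N (count_space UNIV)"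
    and lr: "lr_le M X N Y"
  shows "hr_le M X N Y"
  unfolding hr_le_def
proof
  interpret M: prob_space M by fact
  interpret N: prob_space N by fact
  fix n
  let ?f = "\<lambda>k. \<P>(x in M. X x = k)" and ?g = "\<lambda>k. \<P>(y in N. Y y = k)"
  let ?F = "\<P>(x in M. X x \<ge> n)" and ?G = "\<P>(y in N. Y y \<ge> n)"
  show "hazard_rate N Y n \<le> hazard_rate M X n"
  proof (cases "?F = 0")
    case False
    then have F: "?F > 0" by (simp add: less_le)
    \<comment> \<open>If the tail of \<open>Y\<close> vanished, a point \<open>n + j\<close> of
      positive mass for \<open>X\<close> would, through the cross inequality, force the masses of
      \<open>Y\<close> below \<open>n\<close> to vanish as well, leaving total mass 0.\<close>
    have G: "?G > 0"
    proof (rule ccontr)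
      assume "\<not> ?G > 0"
      then have G0: "?G = 0" by (simp add: less_le)
      from F obtain j where j: "?f (n + j) \<noteq> 0"
        using sums_unique2[OF M.sums_prob_ge[OF X, of n]] sums_zero by fastforce
      have "?g k = 0" if "k \<ge> n" for k
      proof -
        have "?g k \<le> ?G"
          using that Y by (intro N.finite_measure_mono) auto
        with G0 show ?thesis by (simp add: order_antisym)
      qed
      moreover have "?g k = 0" if "k < n" for k
      proof -
        have "?f (n + j) * ?g k \<le> ?f k * ?g (n + j)"
          using that by (intro lr_le_cross[OF lr]) auto
        also have "?g (n + j) = 0"
          using \<open>\<And>k. k \<ge> n \<Longrightarrow> ?g k = 0\<close> by simp
        finally show ?thesis
          using j by (simp add: mult_le_0_iff measure_le_0_iff)
      qed
      ultimately have "?g k = 0" for k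
        by (cases "k < n") auto
      then have "\<P>(y in N. Y y \<ge> 0) = 0"
        using sums_unique2[OF N.sums_prob_ge[OF Y, of 0]] sums_zero by force
      then show False by (simp add: N.prob_space)
    qed
    have "?g n * ?F \<le> ?f n * ?G"
    proof (rule sums_le)
      show "(\<lambda>k. ?g n * ?f (n + k)) sums (?g n * ?F)"
        by (intro sums_mult M.sums_prob_ge X)
      show "(\<lambda>k. ?f n * ?g (n + k)) sums (?f n * ?G)"
        by (intro sums_mult N.sums_prob_ge Y)
      show "?g n * ?f (n + k) \<le> ?f n * ?g (n + k)" for k
        using lr_le_cross[OF lr, of n "n + k"] by (simp add: mult.commute)
    qed
    with F G show ?thesis
      by (simp add: hazard_rate_def ennreal_leI field_simps)
  qed (simp add: hazard_rate_def)
qed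

text \<open>This is the monotonicity of the quotient of tails in product form, which allows zero
  tails. The induction chains the inequalities for consecutive tails.\<close>

lemma hr_le_tail_cross:
  assumes "prob_space M" and "prob_space N"
    and X: "X \<in> measurable M (count_space UNIV)" and Y: "Y \<in> measurable N (count_space UNIV)"
    and hr: "hr_le M X N Y" and "m \<le> n"
  shows "\<P>(x in M. X x \<ge> n) * \<P>(y in N. Y y \<ge> m) \<le> \<P>(x in M. X x \<ge> m) * \<P>(y in N. Y y \<ge> n)"
  using \<open>m \<le> n\<close>
proof (induction n rule: dec_induct)
  case base
  show ?case by simp
next
  case (step n)
  interpret M: prob_space M by fact
  interpret N: prob_space N by fact
  let ?F = "\<lambda>k. \<P>(x in M. X x \<ge> k)" and ?G = "\<lambda>k. \<P>(y in N. Y y \<ge> k)"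
  let ?f = "\<P>(x in M. X x = n)" and ?g = "\<P>(y in N. Y y = n)"
  have rate: "hazard_rate N Y n \<le> hazard_rate M X n"
    using hr by (simp add: hr_le_def)
  show ?case
  proof (cases "?F n = 0")
    case True
    then have "?F (Suc n) = 0"
      using M.prob_ge_antimono[OF X, of n "Suc n"] by (simp add: order_antisym)
    then show ?thesis by simp
  next
    case False
    then have F: "?F n > 0" by (simp add: less_le)
    \<comment> \<open>A vanishing tail of \<open>Y\<close> would have infinite hazard rate, whereas
      the rate of \<open>X\<close> at \<open>n\<close> is finite.\<close>
    with rate have "?G n \<noteq> 0"
      by (auto simp: hazard_rate_def top_unique split: if_splits)
    then have G: "?G n > 0" by (simp add: less_le)
    have "?g / ?G n \<le> ?f / ?F n"
      using rate F G by (simp add: hazard_rate_def)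
    \<comment> \<open>Point masses are differences of consecutive tails; the product
      \<open>?F n * ?G n\<close> then cancels.\<close>
    then have "(?G n - ?G (Suc n)) * ?F n \<le> (?F n - ?F (Suc n)) * ?G n"
      using F G M.prob_ge_eq_prob_eq_plus[OF X, of n] N.prob_ge_eq_prob_eq_plus[OF Y, of n]
      by (simp add: field_simps)
    then have "?F (Suc n) * ?G n \<le> ?F n * ?G (Suc n)"
      by (simp add: algebra_simps)
    \<comment> \<open>The one-step inequality is joined to the induction hypothesis through the
      common factor \<open>?G n\<close>, which is positive and is cancelled at the end.\<close>
    then have "?F (Suc n) * ?G n * ?G m \<le> ?F n * ?G (Suc n) * ?G m"
      by (intro mult_right_mono) auto
    also have "\<dots> = ?F n * ?G m * ?G (Suc n)"
      by simp
    also have "\<dots> \<le> ?F m * ?G n * ?G (Suc n)"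
      using step.IH by (intro mult_right_mono) auto
    finally have "?F (Suc n) * ?G m * ?G n \<le> ?F m * ?G (Suc n) * ?G n"
      by (simp add: mult_ac)
    with G show ?thesis by simp
  qed
qed

lemma hr_le_imp_st_le:
  assumes "prob_space M" and "prob_space N"
    and "X \<in> measurable M (count_space UNIV)" and "Y \<in> measurable N (count_space UNIV)"
    and "hr_le M X N Y"
  shows "st_le M X N Y"
  unfolding st_le_def
proof
  fix n
  show "\<P>(x in M. X x \<ge> n) \<le> \<P>(y in N. Y y \<ge> n)"
    \<comment> \<open>At 0 both tails equal 1.\<close>
    using hr_le_tail_cross[OF assms, of 0 n] assms(1,2) by (simp add: prob_space.prob_space)
qed

lemma hr_le_imp_mrl_le:
  assumes "prob_space M" and "prob_space N"
    and X: "X \<in> measurable M (count_space UNIV)" and Y: "Y \<in> measurable N (count_space UNIV)"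
    and hr: "hr_le M X N Y"
  shows "mrl_le M X N Y"
  unfolding mrl_le_def
proof
  interpret M: prob_space M by fact
  interpret N: prob_space N by fact
  fix n
  let ?F = "\<lambda>k. \<P>(x in M. X x \<ge> k)" and ?G = "\<lambda>k. \<P>(y in N. Y y \<ge> k)"
  have "ennreal (?F (n + Suc t)) / ennreal (?F n) \<le> ennreal (?G (n + Suc t)) / ennreal (?G n)" for t
  proof (cases "?F n = 0")
    case True
    \<comment> \<open>The left quotient is then 0/0, which is 0 in \<open>ennreal\<close>.\<close>
    then have "?F (n + Suc t) = 0"
      using M.prob_ge_antimono[OF X, of n "n + Suc t"] by (simp add: order_antisym)
    then show ?thesis by simp
  next
    case False
    then have F: "?F n > 0" by (simp add: less_le)
    also have "?F n \<le> ?G n"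
      using hr_le_imp_st_le[OF assms] by (simp add: st_le_def)
    finally have G: "?G n > 0" .
    have "?F (n + Suc t) * ?G n \<le> ?F n * ?G (n + Suc t)"
      by (rule hr_le_tail_cross[OF assms]) simp
    then have "?F (n + Suc t) / ?F n \<le> ?G (n + Suc t) / ?G n"
      using F G by (simp add: field_simps)
    then show ?thesis
      using F G by (simp add: divide_ennreal ennreal_leI)
  qed
  then show "mean_residual_life M X n \<le> mean_residual_life N Y n"
    unfolding M.mean_residual_life_eq_suminf[OF X] N.mean_residual_life_eq_suminf[OF Y]
    by (intro suminf_le) auto
qed

section \<open>Likelihood ratio of two COM-negative binomial laws\<close>

lemma cmnb_weight_pos:
  assumes "r > 0" and "0 < p" and "p < 1"
  shows "cmnb_weight r \<nu> p k > 0"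
  using assms by (simp add: cmnb_weight_def Gamma_real_pos add_pos_nonneg less_imp_neq[THEN not_sym])

text \<open>Positivity of the constant comes from the total mass \<open>1\<close>, without discussing the convergence
  of the series that defines it.\<close>

lemma has_cmnb_const_pos:
  assumes "prob_space M" and X: "has_cmnb M X r \<nu> p" and "r > 0" and "0 < p" and "p < 1"
  shows "cmnb_const r \<nu> p > 0"
proof (rule ccontr)
  interpret prob_space M by fact
  have meas: "X \<in> measurable M (count_space UNIV)"
    and eq: "\<P>(x in M. X x = k) = cmnb_weight r \<nu> p k * (1 / cmnb_const r \<nu> p)" for k
    using X by (auto simp: has_cmnb_def)
  assume "\<not> cmnb_const r \<nu> p > 0"
  \<comment> \<open>This includes a constant equal to 0, since division by zero yields 0.\<close>
  then have "\<P>(x in M. X x = k) \<le> 0" for k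
    using cmnb_weight_pos[OF assms(3-5), of \<nu> k]
    by (simp add: eq divide_le_0_iff)
  then have "\<P>(x in M. X x = k) = 0" for k
    by (simp add: order_antisym)
  then have "\<P>(x in M. X x \<ge> 0) = 0"
    using sums_unique2[OF sums_prob_ge[OF meas, of 0]] sums_zero by force
  then show False by (simp add: prob_space)
qed

lemma has_cmnb_lr_le:
  assumes "prob_space M" and "prob_space N"
    and X: "has_cmnb M X r \<nu> p" and Y: "has_cmnb N Y r \<nu> q"
    and "r > 0" and "0 < p" and "p \<le> q" and "q < 1"
  shows "lr_le M X N Y"
  unfolding lr_le_def
proof (rule mono_onI)
  fix m n :: nat
  assume "m \<le> n"
  have p: "p < 1" and q: "0 < q" using assms by auto
  \<comment> \<open>\<open>c\<close> is the quotient of the normalising factors, that is, the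
    likelihood ratio at 0.\<close>
  define c where "c = (1 - q) powr r * cmnb_const r \<nu> p / ((1 - p) powr r * cmnb_const r \<nu> q)"
  have Cp: "cmnb_const r \<nu> p > 0"
    using has_cmnb_const_pos[OF assms(1) X] assms p by blast
  have Cq: "cmnb_const r \<nu> q > 0"
    using has_cmnb_const_pos[OF assms(2) Y] assms q by blast
  have c: "c > 0"
    using Cp Cq p \<open>q < 1\<close> by (simp add: c_def)
  have "ennreal (\<P>(y in N. Y y = k)) / ennreal (\<P>(x in M. X x = k)) = ennreal (c * (q / p) ^ k)" for k
  proof -
    let ?a = "Gamma (r + real k) / (fact k * Gamma r)"
    have a: "?a > 0"
      using \<open>r > 0\<close> by (simp add: Gamma_real_pos add_pos_nonneg)
    have f: "\<P>(x in M. X x = k) = ?a powr \<nu> * p ^ k * (1 - p) powr r / cmnb_const r \<nu> p"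
      using X by (simp add: has_cmnb_def cmnb_weight_def)
    have g: "\<P>(y in N. Y y = k) = ?a powr \<nu> * q ^ k * (1 - q) powr r / cmnb_const r \<nu> q"
      using Y by (simp add: has_cmnb_def cmnb_weight_def)
    \<comment> \<open>The coefficient shared by both laws is kept as an opaque positive factor, so
      that it cancels from the quotient.\<close>
    define b where "b = ?a powr \<nu>"
    have b: "b > 0"
      unfolding b_def powr_gt_zero using a by (rule less_imp_neq[THEN not_sym])
    have "\<P>(x in M. X x = k) > 0"
      unfolding f b_def[symmetric] using b Cp p \<open>0 < p\<close> by simp
    moreover have "\<P>(y in N. Y y = k) / \<P>(x in M. X x = k) = c * (q / p) ^ k"
      unfolding f g b_def[symmetric] c_def using b Cp Cq p q \<open>0 < p\<close> \<open>q < 1\<close>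
      by (simp add: field_simps)
    ultimately show ?thesis
      by (simp add: divide_ennreal)
  qed
  moreover have "c * (q / p) ^ m \<le> c * (q / p) ^ n"
    using c \<open>m \<le> n\<close> \<open>0 < p\<close> \<open>p \<le> q\<close>
    by (intro mult_left_mono power_increasing) auto
  ultimately show "ennreal (\<P>(y in N. Y y = m)) / ennreal (\<P>(x in M. X x = m))
      \<le> ennreal (\<P>(y in N. Y y = n)) / ennreal (\<P>(x in M. X x = n))"
    by (simp add: ennreal_leI)
qed

theorem theorem2p3:
  fixes M :: "'a measure" and N :: "'b measure"
    and X :: "'a \<Rightarrow> nat" and Y :: "'b \<Rightarrow> nat"
    and r \<nu> p\<^sub>1 p\<^sub>2 :: real
  assumes "prob_space M" and "prob_space N"
    and "r > 0" and "\<nu> > 0"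
    and "0 < p\<^sub>1" and "p\<^sub>1 < 1" and "0 < p\<^sub>2" and "p\<^sub>2 < 1"
    and "has_cmnb M X r \<nu> p\<^sub>1" and "has_cmnb N Y r \<nu> p\<^sub>2"
    and "(p\<^sub>1 \<le> p\<^sub>2 \<and> \<nu> \<le> 1) \<or> (p\<^sub>1 \<le> p\<^sub>2 \<and> r \<ge> 1)"
  shows "lr_le M X N Y \<and> st_le M X N Y \<and> hr_le M X N Y \<and> mrl_le M X N Y"
proof -
  have X: "X \<in> measurable M (count_space UNIV)" and Y: "Y \<in> measurable N (count_space UNIV)"
    using assms by (auto simp: has_cmnb_def)
  have lr: "lr_le M X N Y"
    using assms by (intro has_cmnb_lr_le[of M N X r \<nu> p\<^sub>1 Y p\<^sub>2]) auto
  have hr: "hr_le M X N Y"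
    by (rule lr_le_imp_hr_le[OF assms(1,2) X Y lr])
  show ?thesis
    using lr hr hr_le_imp_st_le[OF assms(1,2) X Y hr] hr_le_imp_mrl_le[OF assms(1,2) X Y hr]
    by blast
qed

end
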